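(* Let $G$ be a group, $k$ a field and $V$ a finite-dimensional representation of $G$ over $k$. Then the set $\mathcal L(V) \subset k[G]$ of Lie elements with respect to $V$ is a representation of $G$, where elements of the group act by conjugation; that is, $\mathcal L(V)$ is a $k$-linear subspace of $k[G]$ and $g x g^{-1} \in \mathcal L(V)$ for all $g \in G$ and $x \in \mathcal L(V)$.
   Context: For $g \in G$ and $m \ge 1$ define linear operators $A_m(g), B_m(g): V^{\wedge m} \to V^{\wedge m}$ on the $m$-th exterior power by $$A_m(g)(v_1 \wedge \dots \wedge v_m) = g(v_1) \wedge \dots \wedge g(v_m),$$ $$B_m(g)(v_1 \wedge \dots \wedge v_m) = \sum_{p=1}^m v_1 \wedge \dots \wedge g(v_p) \wedge \dots \wedge v_m$$ (in the $p$-th summand only $v_p$ is replaced by $g(v_p)$). For $m = 0$ set $A_0(g) = 1$ and $B_0(g) = 0$ as operators $k \to k$. Extend $A_m$ and $B_m$ by $k$-linearity to maps $k[G] \to \operatorname{End}(V^{\wedge m})$. An element $x \in k[G]$ is called a Lie element (with respect to $V$) if $A_m(x) = B_m(x)$ for all $m = 0, 1, \dots, \dim V$; the set of Lie elements is denoted $\mathcal L(V)$. *)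

theory Defs
  imports Complex_Main "HOL-Library.Poly_Mapping" "HOL-Library.Set_Algebras"
begin

text \<open>
  The type \<open>'a \<Rightarrow>\<^sub>0 'k\<close> of finitely supported functions serves twice: as the free \<open>'k\<close>-vector
  space on \<open>'a\<close>, and, for a group \<open>'g\<close>, as the group algebra \<open>k[G]\<close>.  The group is of class
  \<open>group_add\<close>, which is the class of arbitrary (not necessarily commutative) groups, with the
  group law written \<open>+\<close>, the unit \<open>0\<close> and the inverse \<open>-\<close>.  The multiplication that
  \<open>Poly_Mapping\<close> puts on \<open>'g \<Rightarrow>\<^sub>0 'k\<close> is convolution along this law, and \<open>g\<close> as an element of
  \<open>k[G]\<close> is \<open>single g 1\<close>.
\<close>

definition smult :: "'k::field \<Rightarrow> ('a \<Rightarrow>\<^sub>0 'k) \<Rightarrow> ('a \<Rightarrow>\<^sub>0 'k)"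
  where "smult c u = Poly_Mapping.map ((*) c) u"

lemma lookup_smult [simp]: "Poly_Mapping.lookup (smult c u) a = c * Poly_Mapping.lookup u a"
  by (auto simp: smult_def map.rep_eq when_def)

interpretation free_vs: vector_space smult
  by standard (auto intro!: poly_mapping_eqI simp: lookup_add algebra_simps)

definition lin_ext :: "('a \<Rightarrow> ('b \<Rightarrow>\<^sub>0 'k)) \<Rightarrow> ('a \<Rightarrow>\<^sub>0 'k) \<Rightarrow> ('b \<Rightarrow>\<^sub>0 'k::field)"
  where "lin_ext f u = (\<Sum>a\<in>Poly_Mapping.keys u. smult (Poly_Mapping.lookup u a) (f a))"


text \<open>
  The exterior power \<open>V\<^sup>\<and>\<^sup>m\<close> is the free vector space on the lists \<open>[v\<^sub>1, \<dots>, v\<^sub>m]\<close> modulo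
  multilinearity and the vanishing of lists with a repeated entry.  Its elements are the
  cosets of the subspace of relations.  For \<open>m = 0\<close> there are no relations and the only list is
  \<open>[]\<close>, so this is the ground field.
\<close>

definition ext_relators :: "('k::field \<Rightarrow> 'v::ab_group_add \<Rightarrow> 'v) \<Rightarrow> nat \<Rightarrow> ('v list \<Rightarrow>\<^sub>0 'k) set"
  where "ext_relators scale m =
    {Poly_Mapping.single (vs[i := a + b]) 1 - Poly_Mapping.single (vs[i := a]) 1
       - Poly_Mapping.single (vs[i := b]) 1 | vs i a b. length vs = m \<and> i < m}
    \<union> {Poly_Mapping.single (vs[i := scale c a]) 1 - Poly_Mapping.single (vs[i := a]) c
       | vs i a c. length vs = m \<and> i < m}
    \<union> {Poly_Mapping.single vs 1 | vs. length vs = m \<and> (\<exists>i j. i < j \<and> j < m \<and> vs ! i = vs ! j)}"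

definition ext_null :: "('k::field \<Rightarrow> 'v::ab_group_add \<Rightarrow> 'v) \<Rightarrow> nat \<Rightarrow> ('v list \<Rightarrow>\<^sub>0 'k) set"
  where "ext_null scale m = free_vs.span (ext_relators scale m)"

definition ext_power :: "('k::field \<Rightarrow> 'v::ab_group_add \<Rightarrow> 'v) \<Rightarrow> nat \<Rightarrow> ('v list \<Rightarrow>\<^sub>0 'k) set set"
  where "ext_power scale m =
    {u +o ext_null scale m | u. Poly_Mapping.keys u \<subseteq> {vs. length vs = m}}"

definition wedge :: "('k::field \<Rightarrow> 'v::ab_group_add \<Rightarrow> 'v) \<Rightarrow> 'v list \<Rightarrow> ('v list \<Rightarrow>\<^sub>0 'k) set"
  where "wedge scale vs = Poly_Mapping.single vs 1 +o ext_null scale (length vs)"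

text \<open>
  If \<open>T\<close> is linear and preserves the relations, \<open>ext_induced\<close> sends the coset of \<open>u\<close> to the
  coset of \<open>T u\<close>.
\<close>

definition ext_induced ::
    "('k::field \<Rightarrow> 'v::ab_group_add \<Rightarrow> 'v) \<Rightarrow> nat \<Rightarrow> (('v list \<Rightarrow>\<^sub>0 'k) \<Rightarrow> ('v list \<Rightarrow>\<^sub>0 'k))
      \<Rightarrow> ('v list \<Rightarrow>\<^sub>0 'k) set \<Rightarrow> ('v list \<Rightarrow>\<^sub>0 'k) set"
  where "ext_induced scale m T \<omega> = T ` \<omega> + ext_null scale m"

definition ext_A ::
    "('k::field \<Rightarrow> 'v::ab_group_add \<Rightarrow> 'v) \<Rightarrow> ('g \<Rightarrow> 'v \<Rightarrow> 'v) \<Rightarrow> nat \<Rightarrow> 'g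
      \<Rightarrow> ('v list \<Rightarrow>\<^sub>0 'k) set \<Rightarrow> ('v list \<Rightarrow>\<^sub>0 'k) set"
  where "ext_A scale \<rho> m g =
    ext_induced scale m (lin_ext (\<lambda>vs. Poly_Mapping.single (map (\<rho> g) vs) 1))"

definition ext_B ::
    "('k::field \<Rightarrow> 'v::ab_group_add \<Rightarrow> 'v) \<Rightarrow> ('g \<Rightarrow> 'v \<Rightarrow> 'v) \<Rightarrow> nat \<Rightarrow> 'g
      \<Rightarrow> ('v list \<Rightarrow>\<^sub>0 'k) set \<Rightarrow> ('v list \<Rightarrow>\<^sub>0 'k) set"
  where "ext_B scale \<rho> m g =
    ext_induced scale m
      (lin_ext (\<lambda>vs. \<Sum>p<length vs. Poly_Mapping.single (vs[p := \<rho> g (vs ! p)]) 1))"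

text \<open>
  The \<open>k\<close>-linear extension of \<open>Op :: G \<rightarrow> End(V\<^sup>\<and>\<^sup>m)\<close> to \<open>k[G]\<close>.  The linear combination of cosets
  is taken elementwise; adding the zero coset \<open>ext_null\<close> matters only for the empty sum, which
  is otherwise the set \<open>{0}\<close>.
\<close>

definition ext_lin ::
    "('k::field \<Rightarrow> 'v::ab_group_add \<Rightarrow> 'v) \<Rightarrow> nat
      \<Rightarrow> ('g \<Rightarrow> ('v list \<Rightarrow>\<^sub>0 'k) set \<Rightarrow> ('v list \<Rightarrow>\<^sub>0 'k) set)
      \<Rightarrow> ('g \<Rightarrow>\<^sub>0 'k) \<Rightarrow> ('v list \<Rightarrow>\<^sub>0 'k) set \<Rightarrow> ('v list \<Rightarrow>\<^sub>0 'k) set"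
  where "ext_lin scale m Op x \<omega> =
    (\<Sum>g\<in>Poly_Mapping.keys x. smult (Poly_Mapping.lookup x g) ` Op g \<omega>) + ext_null scale m"

definition lie_elements ::
    "('k::field \<Rightarrow> 'v::ab_group_add \<Rightarrow> 'v) \<Rightarrow> ('g::group_add \<Rightarrow> 'v \<Rightarrow> 'v) \<Rightarrow> ('g \<Rightarrow>\<^sub>0 'k) set"
  where "lie_elements scale \<rho> =
    {x. \<forall>m \<le> vector_space.dim scale UNIV. \<forall>\<omega> \<in> ext_power scale m.
       ext_lin scale m (ext_A scale \<rho> m) x \<omega> = ext_lin scale m (ext_B scale \<rho> m) x \<omega>}"

locale group_representation = vector_space scale
  for scale :: "'k::field \<Rightarrow> 'v::ab_group_add \<Rightarrow> 'v" +
  fixes \<rho> :: "'g::group_add \<Rightarrow> 'v \<Rightarrow> 'v"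
  assumes linear_rep: "Vector_Spaces.linear scale scale (\<rho> g)"
    and rep_unit: "\<rho> 0 = id"
    and rep_mult: "\<rho> (g + h) = \<rho> g \<circ> \<rho> h"


text \<open>
  The operators are well defined on cosets (\<open>ext_A_coset\<close>, \<open>ext_B_coset\<close>) and satisfy the
  usual formulas on decomposable elements (\<open>ext_A_wedge\<close>, \<open>ext_B_wedge\<close>).
\<close>

lemma lin_ext_superset:
  assumes "finite S" "Poly_Mapping.keys u \<subseteq> S"
  shows "lin_ext f u = (\<Sum>a\<in>S. smult (Poly_Mapping.lookup u a) (f a))"
  unfolding lin_ext_def
  by (rule sum.mono_neutral_left) (use assms in \<open>auto simp: not_in_keys_iff_lookup_eq_zero\<close>)

lemma lin_ext_single [simp]: "lin_ext f (Poly_Mapping.single a c) = smult c (f a)"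
  by (subst lin_ext_superset[of "{a}"]) auto

lemma lin_ext_linear:
  fixes f :: "'a \<Rightarrow> ('b \<Rightarrow>\<^sub>0 'c::field)"
  shows "Vector_Spaces.linear smult smult (lin_ext f)"
proof (unfold_locales)
  fix u v :: "'a \<Rightarrow>\<^sub>0 'c" and c :: 'c
  let ?S = "Poly_Mapping.keys u \<union> Poly_Mapping.keys v"
  have "Poly_Mapping.keys (u + v) \<subseteq> ?S" by (rule keys_add)
  then show "lin_ext f (u + v) = lin_ext f u + lin_ext f v"
    by (simp add: lin_ext_superset[of ?S] lookup_add free_vs.scale_left_distrib sum.distrib)
  have "Poly_Mapping.keys (smult c u) \<subseteq> Poly_Mapping.keys u"
    by (auto simp: in_keys_iff)
  then show "lin_ext f (smult c u) = smult c (lin_ext f u)"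
    by (simp add: lin_ext_superset[of "Poly_Mapping.keys u"] free_vs.scale_sum_right)
qed

lemma smult_single [simp]: "smult c (Poly_Mapping.single a d) = Poly_Mapping.single a (c * d)"
  by (rule poly_mapping_eqI) (auto simp: lookup_single when_def)

lemma subspace_ext_null: "free_vs.subspace (ext_null scale m)"
  by (simp add: ext_null_def)

lemma ext_null_add:
  assumes "length vs = m" "i < m"
  shows "Poly_Mapping.single (vs[i := a + b]) 1 - Poly_Mapping.single (vs[i := a]) 1
    - Poly_Mapping.single (vs[i := b]) 1 \<in> ext_null scale m"
  unfolding ext_null_def ext_relators_def
  by (rule free_vs.span_base, rule UnI1, rule UnI1, intro CollectI exI conjI, rule refl)
    (use assms in simp_all)

lemma ext_null_scale:
  assumes "length vs = m" "i < m"
  shows "Poly_Mapping.single (vs[i := scale c a]) 1 - Poly_Mapping.single (vs[i := a]) c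
    \<in> ext_null scale m"
  unfolding ext_null_def ext_relators_def
  by (rule free_vs.span_base, rule UnI1, rule UnI2, intro CollectI exI conjI, rule refl)
    (use assms in simp_all)

lemma ext_null_alt:
  assumes "length vs = m" "i < m" "j < m" "i \<noteq> j" "vs ! i = vs ! j"
  shows "Poly_Mapping.single vs 1 \<in> ext_null scale m"
proof -
  have "length vs = m \<and> (\<exists>i j. i < j \<and> j < m \<and> vs ! i = vs ! j)"
    using assms by (metis linorder_neqE_nat)
  then have "Poly_Mapping.single vs 1 \<in> ext_relators scale m"
    unfolding ext_relators_def by (intro UnI2 CollectI exI[of _ vs] conjI[OF refl])
  then show ?thesis
    unfolding ext_null_def by (rule free_vs.span_base)
qed

lemma ext_induced_coset:
  assumes T: "Vector_Spaces.linear smult smult T"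
    and rel: "\<And>r. r \<in> ext_relators scale m \<Longrightarrow> T r \<in> ext_null scale m"
  shows "ext_induced scale m T (u +o ext_null scale m) = T u +o ext_null scale m"
proof -
  interpret T: Vector_Spaces.linear smult smult T by (rule T)
  have sub: "T r \<in> ext_null scale m" if "r \<in> ext_null scale m" for r
    using that unfolding ext_null_def
  proof (induction rule: free_vs.span_induct_alt)
    case base
    then show ?case by (simp add: T.zero free_vs.span_zero)
  next
    case (step c x y)
    then show ?case
      using rel[of x] unfolding ext_null_def
      by (simp add: T.add T.scale free_vs.span_add free_vs.span_scale)
  qed
  have N: "0 \<in> ext_null scale m" "\<And>a b. a \<in> ext_null scale m \<Longrightarrow> b \<in> ext_null scale m \<Longrightarrow>
      a + b \<in> ext_null scale m"
    using subspace_ext_null[of scale m] free_vs.subspace_0 free_vs.subspace_add by blast+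
  show ?thesis
  proof (intro equalityI subsetI)
    fix y assume "y \<in> ext_induced scale m T (u +o ext_null scale m)"
    then obtain r s where rs: "r \<in> ext_null scale m" "s \<in> ext_null scale m" "y = T (u + r) + s"
      by (auto simp: ext_induced_def set_plus_def elt_set_plus_def)
    then have "y = T u + (T r + s)" by (simp add: T.add add.assoc)
    then show "y \<in> T u +o ext_null scale m"
      using rs N(2) sub by (auto simp: elt_set_plus_def)
  next
    fix y assume "y \<in> T u +o ext_null scale m"
    then obtain s where s: "s \<in> ext_null scale m" "y = T u + s"
      by (auto simp: elt_set_plus_def)
    have "u \<in> u +o ext_null scale m"
      using N(1) by (force simp: elt_set_plus_def)
    then show "y \<in> ext_induced scale m T (u +o ext_null scale m)"
      using s by (auto simp: ext_induced_def set_plus_def)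
  qed
qed

lemma ext_null_absorb: "ext_null scale m + ext_null scale m = ext_null scale m"
proof (rule set_eqI, rule iffI)
  fix y assume "y \<in> ext_null scale m + ext_null scale m"
  then obtain a b where "y = a + b" "a \<in> ext_null scale m" "b \<in> ext_null scale m"
    unfolding set_plus_def by blast
  then show "y \<in> ext_null scale m"
    using free_vs.subspace_add[OF subspace_ext_null] by blast
next
  fix y assume y: "y \<in> ext_null scale m"
  have "0 \<in> ext_null scale m"
    by (rule free_vs.subspace_0[OF subspace_ext_null])
  from set_plus_intro[OF this y] show "y \<in> ext_null scale m + ext_null scale m"
    by (simp only: add_0_left)
qed

lemma ext_null_sum:
  assumes "finite I"
  shows "(\<Sum>i\<in>I. f i +o ext_null scale m) + ext_null scale m = (\<Sum>i\<in>I. f i) +o ext_null scale m"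
  using assms
proof (induction I)
  case empty
  then show ?case by (simp add: elt_set_plus_def)
next
  case (insert i I)
  have "(\<Sum>i\<in>insert i I. f i +o ext_null scale m) + ext_null scale m =
      (f i +o ext_null scale m) + ((\<Sum>i\<in>I. f i) +o ext_null scale m)"
    unfolding insert.IH[symmetric] sum.insert[OF insert.hyps] by (rule add.assoc)
  also have "\<dots> = (\<Sum>i\<in>insert i I. f i) +o ext_null scale m"
    by (simp only: set_plus_rearrange ext_null_absorb sum.insert[OF insert.hyps])
  finally show ?case .
qed

context group_representation
begin

lemma rep_add: "\<rho> g (a + b) = \<rho> g a + \<rho> g b"
  using linear_rep[of g] by (simp add: Vector_Spaces.linear_iff)

lemma rep_scale: "\<rho> g (scale c a) = scale c (\<rho> g a)"
  using linear_rep[of g] by (simp add: Vector_Spaces.linear_iff)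

lemma ext_A_coset:
  "ext_A scale \<rho> m g (u +o ext_null scale m) =
    lin_ext (\<lambda>vs. Poly_Mapping.single (map (\<rho> g) vs) 1) u +o ext_null scale m"
  unfolding ext_A_def
proof (rule ext_induced_coset[OF lin_ext_linear])
  let ?f = "\<lambda>vs. Poly_Mapping.single (map (\<rho> g) vs) (1::'k)"
  interpret T: Vector_Spaces.linear smult smult "lin_ext ?f" by (rule lin_ext_linear)
  fix r assume "r \<in> ext_relators scale m"
  then consider
      (a) vs i a b where "length vs = m" "i < m"
        "r = Poly_Mapping.single (vs[i := a + b]) 1 - Poly_Mapping.single (vs[i := a]) 1
          - Poly_Mapping.single (vs[i := b]) 1"
    | (b) vs i a c where "length vs = m" "i < m"
        "r = Poly_Mapping.single (vs[i := scale c a]) 1 - Poly_Mapping.single (vs[i := a]) c"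
    | (c) vs i j where "length vs = m" "i < j" "j < m" "vs ! i = vs ! j"
        "r = Poly_Mapping.single vs 1"
    unfolding ext_relators_def by blast
  then show "lin_ext ?f r \<in> ext_null scale m"
  proof cases
    case a
    then show ?thesis
      using ext_null_add[of "map (\<rho> g) vs" m i "\<rho> g a" "\<rho> g b" scale]
      by (simp add: T.diff map_update rep_add)
  next
    case b
    then show ?thesis
      using ext_null_scale[of "map (\<rho> g) vs" m i scale c "\<rho> g a"]
      by (simp add: T.diff map_update rep_scale)
  next
    case c
    then show ?thesis
      using ext_null_alt[of "map (\<rho> g) vs" m i j scale] by simp
  qed
qed

lemma ext_B_coset:
  "ext_B scale \<rho> m g (u +o ext_null scale m) =
    lin_ext (\<lambda>vs. \<Sum>p<length vs. Poly_Mapping.single (vs[p := \<rho> g (vs ! p)]) 1) u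
      +o ext_null scale m"
  unfolding ext_B_def
proof (rule ext_induced_coset[OF lin_ext_linear])
  let ?s = "\<lambda>vs. Poly_Mapping.single vs (1::'k)"
  let ?f = "\<lambda>vs. \<Sum>p<length vs. ?s (vs[p := \<rho> g (vs ! p)])"
  let ?N = "ext_null scale m"
  interpret T: Vector_Spaces.linear smult smult "lin_ext ?f" by (rule lin_ext_linear)
  note sub = subspace_ext_null[of scale m]
  note sumN = free_vs.subspace_sum[OF sub]
  fix r assume "r \<in> ext_relators scale m"
  then consider
      (a) vs i a b where "length vs = m" "i < m"
        "r = ?s (vs[i := a + b]) - ?s (vs[i := a]) - ?s (vs[i := b])"
    | (b) vs i a c where "length vs = m" "i < m"
        "r = ?s (vs[i := scale c a]) - Poly_Mapping.single (vs[i := a]) c"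
    | (c) vs i j where "length vs = m" "i < j" "j < m" "vs ! i = vs ! j" "r = ?s vs"
    unfolding ext_relators_def by blast
  then show "lin_ext ?f r \<in> ?N"
  proof cases
    case a
    let ?t = "\<lambda>p x. ?s (vs[i := x, p := \<rho> g (vs[i := x] ! p)])"
    have "lin_ext ?f r = (\<Sum>p<m. ?t p (a + b) - ?t p a - ?t p b)"
      using a by (simp add: T.diff sum_subtractf)
    also have "\<dots> \<in> ?N"
    proof (rule sumN)
      fix p assume "p \<in> {..<m}"
      show "?t p (a + b) - ?t p a - ?t p b \<in> ?N"
      proof (cases "p = i")
        case True
        then show ?thesis
          using ext_null_add[of vs m i "\<rho> g a" "\<rho> g b" scale] a by (simp add: rep_add)
      next
        case False
        then show ?thesis
          using ext_null_add[of "vs[p := \<rho> g (vs ! p)]" m i a b scale] a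
          by (simp add: list_update_swap[of i p])
      qed
    qed
    finally show ?thesis .
  next
    case b
    let ?t = "\<lambda>p x. vs[i := x, p := \<rho> g (vs[i := x] ! p)]"
    have "lin_ext ?f r = (\<Sum>p<m. ?s (?t p (scale c a)) - Poly_Mapping.single (?t p a) c)"
      using b by (simp add: T.diff sum_subtractf free_vs.scale_sum_right)
    also have "\<dots> \<in> ?N"
    proof (rule sumN)
      fix p assume "p \<in> {..<m}"
      show "?s (?t p (scale c a)) - Poly_Mapping.single (?t p a) c \<in> ?N"
      proof (cases "p = i")
        case True
        then show ?thesis
          using ext_null_scale[of vs m i scale c "\<rho> g a"] b by (simp add: rep_scale)
      next
        case False
        then show ?thesis
          using ext_null_scale[of "vs[p := \<rho> g (vs ! p)]" m i scale c a] b
          by (simp add: list_update_swap[of i p])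
      qed
    qed
    finally show ?thesis .
  next
    case c
    let ?x = "vs ! i" let ?y = "\<rho> g (vs ! i)"
    let ?u = "\<lambda>a b. ?s (vs[i := a, j := b])"
    let ?t = "\<lambda>p. ?s (vs[p := \<rho> g (vs ! p)])"
    have alt: "?u a a \<in> ?N" for a
      using c by (intro ext_null_alt[of _ m i j]) auto
    have l: "?u (a + a') b - ?u a b - ?u a' b \<in> ?N" for a a' b
      using ext_null_add[of "vs[j := b]" m i a a' scale] c
      by (simp add: list_update_swap[of i j])
    have r: "?u a (b + b') - ?u a b - ?u a b' \<in> ?N" for a b b'
      using ext_null_add[of "vs[i := a]" m j b b' scale] c by simp
    let ?e1 = "?u (?x + ?y) (?x + ?y) - ?u ?x (?x + ?y) - ?u ?y (?x + ?y)"
    let ?e2 = "?u ?x (?x + ?y) - ?u ?x ?x - ?u ?x ?y"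
    let ?e3 = "?u ?y (?x + ?y) - ?u ?y ?x - ?u ?y ?y"
    have ti: "?t i = ?u ?y ?x"
    proof -
      have "vs[i := ?y, j := ?x] = vs[i := ?y]"
        using c by (simp add: list_update_same_conv)
      then show ?thesis by simp
    qed
    have tj: "?t j = ?u ?x ?y" by (simp only: list_update_id c(4)[symmetric])
    have grp: "p + q = w - a - b - (w - s - t) - (s - a - q) - (t - p - b)"
      for p q w s t a b :: "'v list \<Rightarrow>\<^sub>0 'k"
      by (simp add: algebra_simps)
    have "?t i + ?t j = ?u (?x + ?y) (?x + ?y) - ?u ?x ?x - ?u ?y ?y - ?e1 - ?e2 - ?e3"
      unfolding ti tj by (rule grp)
    also have "\<dots> \<in> ?N"
      by (intro free_vs.subspace_diff[OF sub] alt l r)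
    finally have ij: "?t i + ?t j \<in> ?N" .
    have rest: "(\<Sum>p\<in>{..<m} - {i, j}. ?t p) \<in> ?N"
    proof (rule sumN)
      fix p assume "p \<in> {..<m} - {i, j}"
      then show "?t p \<in> ?N"
        using c by (intro ext_null_alt[of _ m i j]) auto
    qed
    have "lin_ext ?f r = (\<Sum>p<m. ?t p)"
      using c by simp
    also have "\<dots> = (\<Sum>p\<in>{i, j}. ?t p) + (\<Sum>p\<in>{..<m} - {i, j}. ?t p)"
      using c by (subst add.commute, intro sum.subset_diff) auto
    also have "\<dots> = (?t i + ?t j) + (\<Sum>p\<in>{..<m} - {i, j}. ?t p)"
      using c by simp
    also have "\<dots> \<in> ?N"
      by (rule free_vs.subspace_add[OF sub ij rest])
    finally show ?thesis .
  qed
qed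

lemma ext_A_wedge: "ext_A scale \<rho> (length vs) g (wedge scale vs) = wedge scale (map (\<rho> g) vs)"
  by (simp add: wedge_def ext_A_coset)

lemma ext_B_wedge:
  "ext_B scale \<rho> (length vs) g (wedge scale vs) =
    (\<Sum>p<length vs. wedge scale (vs[p := \<rho> g (vs ! p)])) + ext_null scale (length vs)"
  by (simp add: wedge_def ext_B_coset ext_null_sum)

end

end

theory Submission
  imports Defs
begin

text \<open>
  Already on the free vector spaces spanned by lists, conjugating the operators of \<open>x\<close> by
  \<open>A\<^sub>m(g)\<close> gives the operators of \<open>g x g\<^sup>-\<^sup>1\<close>, both for \<open>A\<^sub>m\<close> and for \<open>B\<^sub>m\<close>.  Since \<open>A\<^sub>m(g)\<close>
  preserves the relations of the exterior power, it carries \<open>A\<^sub>m(x) = B\<^sub>m(x)\<close> to the same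
  identity for \<open>g x g\<^sup>-\<^sup>1\<close>.
\<close>

lemma lin_ext_add: "lin_ext f (u + v) = lin_ext f u + lin_ext f v"
  and lin_ext_smult: "lin_ext f (smult c u) = smult c (lin_ext f u)"
  and lin_ext_zero [simp]: "lin_ext f 0 = 0"
  and lin_ext_sum: "lin_ext f (sum h I) = (\<Sum>i\<in>I. lin_ext f (h i))"
proof -
  interpret T: Vector_Spaces.linear smult smult "lin_ext f" by (rule lin_ext_linear)
  show "lin_ext f (u + v) = lin_ext f u + lin_ext f v" by (rule T.add)
  show "lin_ext f (smult c u) = smult c (lin_ext f u)" by (rule T.scale)
  show "lin_ext f 0 = 0" by (rule T.zero)
  show "lin_ext f (sum h I) = (\<Sum>i\<in>I. lin_ext f (h i))" by (rule T.sum)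
qed

text \<open>Lets an identity between composites of linear extensions be checked on single basis
  elements.\<close>

lemma lin_ext_lin_ext: "lin_ext f (lin_ext h u) = lin_ext (\<lambda>a. lin_ext f (h a)) u"
  unfolding lin_ext_def[of h] lin_ext_def[of "\<lambda>a. lin_ext f (h a)"]
  by (simp add: lin_ext_sum lin_ext_smult)

lemma lin_ext_diff_fun: "lin_ext (\<lambda>a. f a - h a) u = lin_ext f u - lin_ext h u"
  by (simp add: lin_ext_def free_vs.scale_right_diff_distrib sum_subtractf)

text \<open>Both sides are additive in \<open>x\<close>, and on \<open>single a c\<close> the
  convolution product is \<open>single (g + a - g) c\<close>.\<close>

lemma lin_ext_conj:
  fixes g :: "'g::group_add" and x :: "'g \<Rightarrow>\<^sub>0 'k::field"
  shows "lin_ext f (Poly_Mapping.single g 1 * x * Poly_Mapping.single (- g) 1)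
    = lin_ext (\<lambda>h. f (g + h - g)) x"
proof (induction x rule: update_induct)
  case const
  then show ?case by simp
next
  case (update x a c)
  \<comment> \<open>The key \<open>a\<close> is fresh for \<open>x\<close>, so overwriting its
    coefficient amounts to adding a monomial.\<close>
  have "Poly_Mapping.update a c x = x + Poly_Mapping.single a c"
    using update.hyps(1)
    by (intro poly_mapping_eqI)
      (auto simp: lookup_update lookup_add lookup_single when_def in_keys_iff)
  then show ?case
    using update.IH
    by (simp add: mult_single distrib_left distrib_right lin_ext_add diff_conv_add_uminus
        del: add_uminus_conv_diff)
qed

lemma keys_lin_ext_subset:
  assumes "\<And>a. a \<in> Poly_Mapping.keys u \<Longrightarrow> Poly_Mapping.keys (f a) \<subseteq> K"
  shows "Poly_Mapping.keys (lin_ext f u) \<subseteq> K"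
proof
  fix b assume "b \<in> Poly_Mapping.keys (lin_ext f u)"
  then have "(\<Sum>a\<in>Poly_Mapping.keys u. Poly_Mapping.lookup u a * Poly_Mapping.lookup (f a) b) \<noteq> 0"
    by (simp add: lin_ext_def in_keys_iff lookup_sum)
  then obtain a where "a \<in> Poly_Mapping.keys u"
      "Poly_Mapping.lookup u a * Poly_Mapping.lookup (f a) b \<noteq> 0"
    by (meson sum.not_neutral_contains_not_neutral)
  then show "b \<in> K" using assms[of a] by (auto simp: in_keys_iff)
qed

lemma coset_eq_iff:
  "u +o ext_null scale m = v +o ext_null scale m \<longleftrightarrow> u - v \<in> ext_null scale m"
proof -
  let ?N = "ext_null scale m"
  note sub = subspace_ext_null[of scale m]
  have mem: "y \<in> w +o ?N \<longleftrightarrow> y - w \<in> ?N" for y w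
    by (auto simp: elt_set_plus_def algebra_simps intro: bexI[of _ "y - w"])
  show ?thesis
  proof
    assume eq: "u +o ?N = v +o ?N"
    have "u \<in> u +o ?N" using free_vs.subspace_0[OF sub] by (simp add: mem)
    then show "u - v \<in> ?N" by (simp add: eq mem)
  next
    assume d: "u - v \<in> ?N"
    show "u +o ?N = v +o ?N"
    proof (rule set_eqI)
      fix y
      have "y - v = (y - u) + (u - v)" "y - u = (y - v) - (u - v)" by simp_all
      then have "y - u \<in> ?N \<longleftrightarrow> y - v \<in> ?N"
        using d free_vs.subspace_add[OF sub] free_vs.subspace_diff[OF sub] by metis
      then show "y \<in> u +o ?N \<longleftrightarrow> y \<in> v +o ?N" by (simp add: mem)
    qed
  qed
qed

text \<open>Multiplication by a nonzero \<open>c\<close> maps a subspace onto itself, the preimage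
  of \<open>y\<close> being \<open>smult (inverse c) y\<close>. For \<open>c = 0\<close> the image
  would be \<open>{0}\<close> instead of the zero coset.\<close>

lemma smult_coset:
  fixes scale :: "'a::field \<Rightarrow> 'b::ab_group_add \<Rightarrow> 'b"
  assumes "c \<noteq> 0"
  shows "smult c ` (u +o ext_null scale m) = smult c u +o ext_null scale m"
proof -
  have translate: "w +o S = (+) w ` S" for w and S :: "('b list \<Rightarrow>\<^sub>0 'a) set"
    by (auto simp: elt_set_plus_def)
  note scale_mem = free_vs.subspace_scale[OF subspace_ext_null[of scale m]]
  have "smult c ` ext_null scale m = ext_null scale m"
  proof (intro equalityI subsetI)
    fix y assume "y \<in> ext_null scale m"
    then have "smult (inverse c) y \<in> ext_null scale m" by (rule scale_mem)
    moreover have "y = smult c (smult (inverse c) y)" using assms by simp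
    ultimately show "y \<in> smult c ` ext_null scale m" by blast
  qed (use scale_mem in blast)
  then have "smult c u +o ext_null scale m = smult c u +o smult c ` ext_null scale m" by simp
  also have "\<dots> = smult c ` (u +o ext_null scale m)"
    by (simp add: translate image_image free_vs.scale_right_distrib)
  finally show ?thesis ..
qed

text \<open>The sum runs over keys of \<open>x\<close>, whose coefficients are nonzero, so
  \<open>smult_coset\<close> applies to each summand.\<close>

lemma ext_lin_coset:
  assumes "\<And>g. Op g (u +o ext_null scale m) = T g +o ext_null scale m"
  shows "ext_lin scale m Op x (u +o ext_null scale m) = lin_ext T x +o ext_null scale m"
proof -
  have "(\<Sum>g\<in>Poly_Mapping.keys x. smult (Poly_Mapping.lookup x g) ` Op g (u +o ext_null scale m))
      = (\<Sum>g\<in>Poly_Mapping.keys x. smult (Poly_Mapping.lookup x g) (T g) +o ext_null scale m)"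
    by (rule sum.cong) (simp_all add: assms smult_coset in_keys_iff)
  then show ?thesis
    by (simp add: ext_lin_def lin_ext_def ext_null_sum)
qed

context group_representation
begin

text \<open>Lifts of the operators to the free space on lists of all lengths at once. Here
  conjugation holds as an exact equation, not just modulo the relations.\<close>

definition free_A :: "'g \<Rightarrow> ('v list \<Rightarrow>\<^sub>0 'k) \<Rightarrow> ('v list \<Rightarrow>\<^sub>0 'k)"
  where "free_A g = lin_ext (\<lambda>vs. Poly_Mapping.single (map (\<rho> g) vs) 1)"

definition free_B :: "'g \<Rightarrow> ('v list \<Rightarrow>\<^sub>0 'k) \<Rightarrow> ('v list \<Rightarrow>\<^sub>0 'k)"
  where "free_B g =
    lin_ext (\<lambda>vs. \<Sum>p<length vs. Poly_Mapping.single (vs[p := \<rho> g (vs ! p)]) 1)"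

text \<open>Cosets agree exactly when their representatives differ by a null element, so the
  equality of operators becomes, for each \<open>u\<close>, a membership condition linear in
  \<open>x\<close>.\<close>

lemma lie_elements_iff:
  "x \<in> lie_elements scale \<rho> \<longleftrightarrow>
    (\<forall>m \<le> vector_space.dim scale UNIV. \<forall>u. Poly_Mapping.keys u \<subseteq> {vs. length vs = m} \<longrightarrow>
      lin_ext (\<lambda>g. free_A g u - free_B g u) x \<in> ext_null scale m)"
proof -
  have "ext_lin scale m (ext_A scale \<rho> m) x (u +o ext_null scale m)
      = lin_ext (\<lambda>g. free_A g u) x +o ext_null scale m" for m u
    by (rule ext_lin_coset) (simp add: ext_A_coset free_A_def)
  moreover have "ext_lin scale m (ext_B scale \<rho> m) x (u +o ext_null scale m)
      = lin_ext (\<lambda>g. free_B g u) x +o ext_null scale m" for m u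
    by (rule ext_lin_coset) (simp add: ext_B_coset free_B_def)
  ultimately have "ext_lin scale m (ext_A scale \<rho> m) x (u +o ext_null scale m)
        = ext_lin scale m (ext_B scale \<rho> m) x (u +o ext_null scale m)
      \<longleftrightarrow> lin_ext (\<lambda>g. free_A g u - free_B g u) x \<in> ext_null scale m" for m u
    by (simp add: coset_eq_iff lin_ext_diff_fun)
  then show ?thesis
    unfolding lie_elements_def ext_power_def by blast
qed

text \<open>This is the well-definedness of \<open>ext_A\<close> on cosets: \<open>u\<close> and 0
  represent the same coset, hence so do their images.\<close>

lemma free_A_null:
  assumes "u \<in> ext_null scale m"
  shows "free_A g u \<in> ext_null scale m"
proof -
  have "u +o ext_null scale m = 0 +o ext_null scale m"
    using assms by (simp only: coset_eq_iff diff_zero)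
  then have "free_A g u +o ext_null scale m = free_A g 0 +o ext_null scale m"
    using ext_A_coset[of m g u] ext_A_coset[of m g 0] unfolding free_A_def by (simp only:)
  then have "free_A g u - free_A g 0 \<in> ext_null scale m" by (simp only: coset_eq_iff)
  then show ?thesis by (simp add: free_A_def)
qed

lemma free_A_conj: "free_A (g + h - g) u = free_A g (free_A h (free_A (- g) u))"
  by (simp add: free_A_def lin_ext_lin_ext rep_mult diff_conv_add_uminus o_assoc
      del: add_uminus_conv_diff)

text \<open>On a list, every entry is hit by \<open>\<rho> (- g)\<close> first and by
  \<open>\<rho> g\<close> last. These cancel except at position \<open>p\<close>, where
  \<open>\<rho> h\<close> stands between them.\<close>

lemma free_B_conj: "free_B (g + h - g) u = free_A g (free_B h (free_A (- g) u))"
proof -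
  have cancel: "\<rho> g (\<rho> (- g) v) = v" for v
    using rep_mult[of g "- g"] by (simp add: rep_unit fun_eq_iff)
  have "vs[p := \<rho> (g + h - g) (vs ! p)]
      = map (\<rho> g) ((map (\<rho> (- g)) vs)[p := \<rho> h (map (\<rho> (- g)) vs ! p)])"
    if "p < length vs" for vs p
  proof -
    have "map (\<rho> g) (map (\<rho> (- g)) vs) = vs" by (simp add: cancel comp_def)
    moreover have "\<rho> (g + h - g) = \<rho> g \<circ> \<rho> h \<circ> \<rho> (- g)"
      using rep_mult[of "g + h" "- g"] rep_mult[of g h] by simp
    ultimately show ?thesis using that by (simp only: map_update nth_map comp_apply)
  qed
  then show ?thesis
    by (simp add: free_A_def free_B_def lin_ext_lin_ext lin_ext_sum cong: sum.cong_simp)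
qed

text \<open>For each \<open>u\<close> the condition in \<open>lie_elements_iff\<close> describes the
  preimage of a subspace under a linear map in \<open>x\<close>.\<close>

lemma subspace_lie_elements: "free_vs.subspace (lie_elements scale \<rho>)"
proof (rule free_vs.subspaceI)
  note sub = subspace_ext_null[of scale]
  show "0 \<in> lie_elements scale \<rho>"
    by (simp add: lie_elements_iff free_vs.subspace_0[OF sub])
  show "x + y \<in> lie_elements scale \<rho>"
    if "x \<in> lie_elements scale \<rho>" "y \<in> lie_elements scale \<rho>" for x y
    using that by (simp add: lie_elements_iff lin_ext_add free_vs.subspace_add[OF sub])
  show "smult c x \<in> lie_elements scale \<rho>" if "x \<in> lie_elements scale \<rho>" for c x
    using that by (simp add: lie_elements_iff lin_ext_smult free_vs.subspace_scale[OF sub])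
qed

lemma conj_lie_elements:
  assumes x: "x \<in> lie_elements scale \<rho>"
  shows "Poly_Mapping.single g 1 * x * Poly_Mapping.single (- g) 1 \<in> lie_elements scale \<rho>"
  unfolding lie_elements_iff
proof (intro allI impI)
  fix m and u :: "'v list \<Rightarrow>\<^sub>0 'k"
  assume m: "m \<le> vector_space.dim scale UNIV" and u: "Poly_Mapping.keys u \<subseteq> {vs. length vs = m}"
  \<comment> \<open>The condition for the conjugate at \<open>u\<close> follows from the one for
    \<open>x\<close> at \<open>?w\<close>, since the outer factor \<open>free_A g\<close> can be
    pulled out of the sum over \<open>x\<close>.\<close>
  let ?w = "free_A (- g) u"
  have diff: "free_A g (a - b) = free_A g a - free_A g b" for a b
    by (simp add: free_A_def eq_diff_eq flip: lin_ext_add)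
  have "lin_ext (\<lambda>h. free_A h u - free_B h u)
        (Poly_Mapping.single g 1 * x * Poly_Mapping.single (- g) 1)
      = lin_ext (\<lambda>h. free_A g (free_A h ?w - free_B h ?w)) x"
    by (simp add: lin_ext_conj free_A_conj free_B_conj diff)
  also have "\<dots> = free_A g (lin_ext (\<lambda>h. free_A h ?w - free_B h ?w) x)"
    by (simp add: free_A_def lin_ext_lin_ext)
  also have "\<dots> \<in> ext_null scale m"
  proof (rule free_A_null)
    \<comment> \<open>Applying \<open>\<rho> (- g)\<close> entrywise keeps the length of lists, so
      \<open>?w\<close> is an admissible test vector in the same degree.\<close>
    have "Poly_Mapping.keys ?w \<subseteq> {vs. length vs = m}"
      unfolding free_A_def by (rule keys_lin_ext_subset) (use u in auto)
    then show "lin_ext (\<lambda>h. free_A h ?w - free_B h ?w) x \<in> ext_null scale m"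
      using x m by (simp add: lie_elements_iff)
  qed
  finally show "lin_ext (\<lambda>h. free_A h u - free_B h u)
      (Poly_Mapping.single g 1 * x * Poly_Mapping.single (- g) 1) \<in> ext_null scale m" .
qed

end

theorem corollary2:
  fixes scale :: "'k::field \<Rightarrow> 'v::ab_group_add \<Rightarrow> 'v"
    and Basis :: "'v set"
    and \<rho> :: "'g::group_add \<Rightarrow> 'v \<Rightarrow> 'v"
  assumes "finite_dimensional_vector_space scale Basis"
    and "group_representation scale \<rho>"
  shows "module.subspace smult (lie_elements scale \<rho>)
    \<and> (\<forall>g. \<forall>x \<in> lie_elements scale \<rho>.
          Poly_Mapping.single g 1 * x * Poly_Mapping.single (- g) 1 \<in> lie_elements scale \<rho>)"
  using group_representation.subspace_lie_elements[OF assms(2)]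
    group_representation.conj_lie_elements[OF assms(2)] by blast

end
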